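(* Let $N_f>M\ge 1$ be integers, $\beta\ge 0$, $\overline{n},\sigma,\lambda_p,\vartheta>0$ and $\alpha>2$. Let $p_i=i^{-\beta}/\sum_{k=1}^{N_f}k^{-\beta}$ for $i=1,\dots,N_f$. Let $q^*\in[0,1]$ be a maximizer over $[0,1]$ of the rate coverage probability $q\mapsto\Upsilon(q)$ (defined in the context), and write $\Upsilon=\Upsilon(q^* )$. For $\boldsymbol{b}=(b_1,\dots,b_{N_f})\in[0,1]^{N_f}$ let $$\mathbb{P}_o(q^*,\boldsymbol{b})=\sum_{i=1}^{N_f}\left[p_ib_i+p_i(1-b_i)\left(1-e^{-b_i\overline{n}}\right)\Upsilon\right].$$ Then $\boldsymbol{b}\mapsto\mathbb{P}_o(q^*,\boldsymbol{b})$ is a concave function on $[0,1]^{N_f}$, and the optimal solution $\boldsymbol{b}^*=(b_1^*,\dots,b_{N_f}^* )$ of the problem $$\max_{\boldsymbol{b}}\ \mathbb{P}_o(q^*,\boldsymbol{b})\quad\text{subject to}\quad\sum_{i=1}^{N_f}b_i=M,\quad b_i\in[0,1]\ (i=1,\dots,N_f)$$ is given, for each $i$, by $$b_i^*=\begin{cases}1,& v^*<p_i-p_i\left(1-e^{-\overline{n}}\right)\Upsilon,\\ 0,& v^*>p_i+\overline{n}p_i\Upsilon,\\ \psi_i(v^* ),&\text{otherwise},\end{cases}$$ where $\psi_i(v^* )$ is the solution $b_i^*\in[0,1]$ of $$v^*=p_i+p_i\left(\overline{n}(1-b_i^* )e^{-\overline{n}b_i^*}-\left(1-e^{-\overline{n}b_i^*}\right)\right)\Upsilon,$$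 and $v^*\in\mathbb{R}$ is a number for which the resulting vector satisfies $\sum_{i=1}^{N_f}b_i^*=M$.
   Context: Setting: a clustered device-to-device caching network; $\mathbb{P}_o$ is the offloading gain, $b_i$ is the probability that a device caches file $i$, $M$ is the cache size per device, $N_f$ the number of files, $p_i$ the Zipf request probability of file $i$, $\overline{n}$ the mean number of devices per cluster, $\sigma$ the standard deviation of the Gaussian displacement of devices around their cluster center, $\lambda_p$ the density of clusters, $\alpha$ the path loss exponent, $\vartheta$ the required signal-to-interference-ratio threshold, and $q$ the channel access probability. The rate coverage probability is, for $q\in[0,1]$, $$\Upsilon(q)=\int_0^\infty\frac{r}{2\sigma^2}e^{-\frac{r^2}{4\sigma^2}}\,q\,L_1(q,r)\,L_2(q,r)\,dr,$$ where, with $t=\vartheta r^{\alpha}$, $$L_1(q,r)=\exp\left(-2\pi\lambda_p\int_0^\infty\left(1-e^{-q\overline{n}\int_0^\infty\frac{t}{t+u^\alpha}f_U(u\mid v)\,du}\right)v\,dv\right),$$ $$L_2(q,r)=\exp\left(-q\overline{n}\int_0^\infty\frac{t}{t+h^\alpha}\,\frac{h}{2\sigma^2}e^{-\frac{h^2}{4\sigma^2}}\,dh\right),$$ $f_U(u\mid v)=\frac{u}{\sigma^2}\exp\left(-\frac{u^2+v^2}{2\sigma^2}\right)I_0\left(\frac{uv}{\sigma^2}\right)$ is the Rice density, and $I_0$ is the modified Bessel function of the first kind of order zero. $\Upsilon=\Upsilon(q^* )$ does not depend on $\boldsymbol{b}$. *)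

theory Defs
  imports "HOL-Analysis.Analysis"
begin

text \<open>Modified Bessel function of the first kind of order zero, by its power series.\<close>

definition bessel_I0 :: "real \<Rightarrow> real" where
  "bessel_I0 x = (\<Sum>k. (x / 2) ^ (2 * k) / (fact k)\<^sup>2)"

definition rice_density :: "real \<Rightarrow> real \<Rightarrow> real \<Rightarrow> real" where
  "rice_density \<sigma> v u =
     u / \<sigma>\<^sup>2 * exp (- (u\<^sup>2 + v\<^sup>2) / (2 * \<sigma>\<^sup>2)) * bessel_I0 (u * v / \<sigma>\<^sup>2)"

text \<open>
  The parameters of the network are, in this order, the cluster density \<open>lam\<close>, the mean number
  \<open>nbar\<close> of devices per cluster, the displacement standard deviation \<open>\<sigma>\<close>, the threshold
  \<open>\<theta>\<close> and the path loss exponent \<open>\<alpha>\<close>.  The factors \<open>inter_laplace\<close> and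
  \<open>intra_laplace\<close> are \<open>L\<^sub>1(q, r)\<close> and \<open>L\<^sub>2(q, r)\<close>; they account for the interference from
  the other clusters and from the same cluster, respectively.
\<close>

definition inter_laplace ::
  "real \<Rightarrow> real \<Rightarrow> real \<Rightarrow> real \<Rightarrow> real \<Rightarrow> real \<Rightarrow> real \<Rightarrow> real" where
  "inter_laplace lam nbar \<sigma> \<theta> \<alpha> q r =
     (let t = \<theta> * r powr \<alpha> in
      exp (- 2 * pi * lam *
        (LBINT v:{0..}.
           (1 - exp (- q * nbar * (LBINT u:{0..}. t / (t + u powr \<alpha>) * rice_density \<sigma> v u))) * v)))"

definition intra_laplace ::
  "real \<Rightarrow> real \<Rightarrow> real \<Rightarrow> real \<Rightarrow> real \<Rightarrow> real \<Rightarrow> real" where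
  "intra_laplace nbar \<sigma> \<theta> \<alpha> q r =
     (let t = \<theta> * r powr \<alpha> in
      exp (- q * nbar *
        (LBINT h:{0..}. t / (t + h powr \<alpha>) * (h / (2 * \<sigma>\<^sup>2) * exp (- h\<^sup>2 / (4 * \<sigma>\<^sup>2))))))"

definition rate_coverage ::
  "real \<Rightarrow> real \<Rightarrow> real \<Rightarrow> real \<Rightarrow> real \<Rightarrow> real \<Rightarrow> real" where
  "rate_coverage lam nbar \<sigma> \<theta> \<alpha> q =
     (LBINT r:{0..}. r / (2 * \<sigma>\<^sup>2) * exp (- r\<^sup>2 / (4 * \<sigma>\<^sup>2)) * q *
        inter_laplace lam nbar \<sigma> \<theta> \<alpha> q r * intra_laplace nbar \<sigma> \<theta> \<alpha> q r)"

definition zipf_prob :: "real \<Rightarrow> nat \<Rightarrow> nat \<Rightarrow> real" where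
  "zipf_prob \<beta> N i = real i powr (- \<beta>) / (\<Sum>k = 1..N. real k powr (- \<beta>))"

text \<open>
  The files are indexed by a finite type \<open>'n\<close>, so that caching vectors live in \<open>real ^ 'n\<close>;
  \<open>p\<close> gives the request probabilities and \<open>Y\<close> is the rate coverage probability.
\<close>

definition offloading_gain :: "real \<Rightarrow> real \<Rightarrow> ('n::finite \<Rightarrow> real) \<Rightarrow> real ^ 'n \<Rightarrow> real" where
  "offloading_gain nbar Y p b =
     (\<Sum>i\<in>UNIV. p i * b $ i + p i * (1 - b $ i) * (1 - exp (- (b $ i) * nbar)) * Y)"

definition feasible_caching :: "nat \<Rightarrow> real ^ 'n::finite \<Rightarrow> bool" where
  "feasible_caching M b \<longleftrightarrow> (\<Sum>i\<in>UNIV. b $ i) = real M \<and> (\<forall>i. b $ i \<in> {0..1})"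

definition psi_solution :: "real \<Rightarrow> real \<Rightarrow> real \<Rightarrow> real \<Rightarrow> real \<Rightarrow> bool" where
  "psi_solution nbar Y c v x \<longleftrightarrow>
     x \<in> {0..1} \<and>
     v = c + c * (nbar * (1 - x) * exp (- nbar * x) - (1 - exp (- nbar * x))) * Y"

definition psi :: "real \<Rightarrow> real \<Rightarrow> real \<Rightarrow> real \<Rightarrow> real" where
  "psi nbar Y c v = (THE x. psi_solution nbar Y c v x)"

definition caching_prob :: "real \<Rightarrow> real \<Rightarrow> real \<Rightarrow> real \<Rightarrow> real" where
  "caching_prob nbar Y c v =
     (if v < c - c * (1 - exp (- nbar)) * Y then 1
      else if v > c + nbar * c * Y then 0
      else psi nbar Y c v)"

end

theory Submission
  imports Defs
begin

text \<open>
  Each file contributes a function of its own caching probability alone, and the derivative of this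
  contribution is strictly decreasing on the unit interval as soon as \<open>\<Upsilon> > 0\<close>.  Hence the
  Lagrangian separates, the clipped inverse of the derivative is its unique maximizer in each
  coordinate, and a maximizer of the Lagrangian that meets the constraint solves the constrained
  problem.  A multiplier exists by the intermediate value theorem because the clipped inverse is
  continuous.  Finally, \<open>\<Upsilon> > 0\<close> because the maximum is at least the value at \<open>q = 1\<close>, whose
  integrand is positive and dominated by a Rayleigh density.
\<close>

subsection \<open>Positivity of the rate coverage probability\<close>

text \<open>Only even powers occur and \<open>fact k\<close> is at most its square, so the
  exponential series at \<open>(x / 2)\<^sup>2\<close> is a majorant.\<close>

lemma summable_bessel_I0: "summable (\<lambda>k. (x / 2) ^ (2 * k) / (fact k :: real)\<^sup>2)"
proof (rule summable_comparison_test')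
  have "summable (\<lambda>k. y ^ k / fact k)" for y :: real
    using summable_exp[of y] by (simp add: divide_inverse_commute)
  then show "summable (\<lambda>k. ((x / 2)\<^sup>2) ^ k / fact k)" .
  fix k :: nat
  have "norm ((x / 2) ^ (2 * k) / (fact k :: real)\<^sup>2) = ((x / 2)\<^sup>2) ^ k / (fact k)\<^sup>2"
    unfolding power_mult real_norm_def by (rule abs_of_nonneg) simp
  also have "\<dots> \<le> ((x / 2)\<^sup>2) ^ k / fact k"
  proof (rule divide_left_mono)
    show "(fact k :: real) \<le> (fact k)\<^sup>2"
      by (simp add: power2_eq_square)
  qed auto
  finally show "norm ((x / 2) ^ (2 * k) / (fact k :: real)\<^sup>2) \<le> ((x / 2)\<^sup>2) ^ k / fact k" .
qed

lemma bessel_I0_nonneg: "0 \<le> bessel_I0 x"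
  unfolding bessel_I0_def
  by (rule suminf_nonneg[OF summable_bessel_I0]) (simp add: power_mult)

lemma borel_measurable_bessel_I0 [measurable]: "bessel_I0 \<in> borel_measurable borel"
proof -
  have "(\<lambda>x. \<Sum>k. (x / 2) ^ (2 * k) / (fact k :: real)\<^sup>2) \<in> borel_measurable borel"
    by measurable
  then show ?thesis
    by (simp add: bessel_I0_def[abs_def])
qed

text \<open>A divergent integral has the default value 0, so the sign survives in every case. Hence
  the Laplace factors can be bounded without a convergence argument for their inner
  integrals.\<close>

lemma set_lebesgue_integral_nonneg:
  fixes f :: "'a \<Rightarrow> real"
  assumes "\<And>x. x \<in> A \<Longrightarrow> 0 \<le> f x"
  shows "0 \<le> (LINT x:A|M. f x)"
  unfolding set_lebesgue_integral_def
  by (rule integral_nonneg_AE) (use assms in \<open>auto simp: indicator_def\<close>)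

lemma rice_density_nonneg: "0 \<le> u \<Longrightarrow> 0 \<le> rice_density \<sigma> v u"
  unfolding rice_density_def by (simp add: bessel_I0_nonneg)

text \<open>Both nested integrands are nonnegative, which makes the exponent nonpositive. The bound
  serves to dominate the coverage integrand by a Rayleigh density.\<close>

lemma inter_laplace_le_one:
  assumes "0 \<le> lam" "0 \<le> nbar" "0 \<le> \<theta>" "0 \<le> q"
  shows "inter_laplace lam nbar \<sigma> \<theta> \<alpha> q r \<le> 1"
proof -
  define t where "t = \<theta> * r powr \<alpha>"
  define I where "I v = (LBINT u:{0..}. t / (t + u powr \<alpha>) * rice_density \<sigma> v u)" for v
  define J where "J = (LBINT v:{0..}. (1 - exp (- q * nbar * I v)) * v)"
  have "0 \<le> t"
    using assms by (simp add: t_def)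
  then have "0 \<le> I v" for v
    unfolding I_def by (intro set_lebesgue_integral_nonneg) (simp add: rice_density_nonneg)
  then have "0 \<le> J"
    unfolding J_def using assms by (intro set_lebesgue_integral_nonneg) simp
  moreover have "inter_laplace lam nbar \<sigma> \<theta> \<alpha> q r = exp (- 2 * pi * lam * J)"
    unfolding inter_laplace_def Let_def J_def I_def t_def by (rule refl)
  ultimately show ?thesis
    using assms by simp
qed

lemma intra_laplace_le_one:
  assumes "0 \<le> nbar" "0 \<le> \<theta>" "0 \<le> q"
  shows "intra_laplace nbar \<sigma> \<theta> \<alpha> q r \<le> 1"
proof -
  define t where "t = \<theta> * r powr \<alpha>"
  define J where "J = (LBINT h:{0..}. t / (t + h powr \<alpha>) * (h / (2 * \<sigma>\<^sup>2) * exp (- h\<^sup>2 / (4 * \<sigma>\<^sup>2))))"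
  have "0 \<le> t"
    using assms by (simp add: t_def)
  then have "0 \<le> J"
    unfolding J_def by (intro set_lebesgue_integral_nonneg) simp
  moreover have "intra_laplace nbar \<sigma> \<theta> \<alpha> q r = exp (- q * nbar * J)"
    unfolding intra_laplace_def Let_def J_def t_def by (rule refl)
  ultimately show ?thesis
    using assms by simp
qed

lemma inter_laplace_pos: "0 < inter_laplace lam nbar \<sigma> \<theta> \<alpha> q r"
  and intra_laplace_pos: "0 < intra_laplace nbar \<sigma> \<theta> \<alpha> q r"
  by (simp_all add: inter_laplace_def intra_laplace_def Let_def)

section \<open>Measurability of the Laplace factors in the distance \<open>r\<close>\<close>

lemma borel_measurable_inter_laplace [measurable]:
  "inter_laplace lam nbar \<sigma> \<theta> \<alpha> q \<in> borel_measurable borel"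
proof -
  define I where "I r v = (LBINT u:{0..}.
    \<theta> * r powr \<alpha> / (\<theta> * r powr \<alpha> + u powr \<alpha>) * rice_density \<sigma> v u)" for r v
  define J where "J r = (LBINT v:{0..}. (1 - exp (- q * nbar * I r v)) * v)" for r
  \<comment> \<open>Joint measurability in \<open>r\<close> and \<open>v\<close> is required, since
    \<open>I\<close> is itself integrated over \<open>v\<close> with \<open>r\<close> as a
    parameter.\<close>
  have [measurable]: "(\<lambda>x. I (fst x) (snd x)) \<in> borel_measurable (borel \<Otimes>\<^sub>M borel)"
    unfolding I_def set_lebesgue_integral_def rice_density_def
    by (rule lborel.borel_measurable_lebesgue_integral) (unfold case_prod_beta', measurable)
  have [measurable]: "J \<in> borel_measurable borel"
    unfolding J_def[abs_def] set_lebesgue_integral_def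
    by (rule lborel.borel_measurable_lebesgue_integral) (unfold case_prod_beta', measurable)
  have "inter_laplace lam nbar \<sigma> \<theta> \<alpha> q = (\<lambda>r. exp (- 2 * pi * lam * J r))"
    unfolding inter_laplace_def[abs_def] Let_def J_def I_def by (rule refl)
  then show ?thesis
    by simp
qed

lemma borel_measurable_intra_laplace [measurable]:
  "intra_laplace nbar \<sigma> \<theta> \<alpha> q \<in> borel_measurable borel"
proof -
  define J where "J r = (LBINT h:{0..}. \<theta> * r powr \<alpha> / (\<theta> * r powr \<alpha> + h powr \<alpha>) *
    (h / (2 * \<sigma>\<^sup>2) * exp (- h\<^sup>2 / (4 * \<sigma>\<^sup>2))))" for r
  have [measurable]: "J \<in> borel_measurable borel"
    unfolding J_def[abs_def] set_lebesgue_integral_def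
    by (rule lborel.borel_measurable_lebesgue_integral) (unfold case_prod_beta', measurable)
  have "intra_laplace nbar \<sigma> \<theta> \<alpha> q = (\<lambda>r. exp (- q * nbar * J r))"
    unfolding intra_laplace_def[abs_def] Let_def J_def by (rule refl)
  then show ?thesis
    by simp
qed

text \<open>The integrand is the nonnegative derivative of a function that rises from -1 at 0 to 0
  at infinity, so the fundamental theorem of calculus yields integrability.\<close>

lemma set_integrable_rayleigh:
  fixes \<sigma> :: real
  assumes "0 < \<sigma>"
  shows "set_integrable lborel {0..} (\<lambda>r. r / (2 * \<sigma>\<^sup>2) * exp (- r\<^sup>2 / (4 * \<sigma>\<^sup>2)))"
proof -
  have "set_integrable lborel (einterval 0 \<infinity>) (\<lambda>r. r / (2 * \<sigma>\<^sup>2) * exp (- r\<^sup>2 / (4 * \<sigma>\<^sup>2)))"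
  proof (rule interval_integral_FTC_nonneg(1)
      [where F = "\<lambda>r. - exp (- r\<^sup>2 / (4 * \<sigma>\<^sup>2))" and A = "-1" and B = 0])
    show "((((\<lambda>r. - exp (- r\<^sup>2 / (4 * \<sigma>\<^sup>2))) \<circ> real_of_ereal) \<longlongrightarrow> - 1) (at_right 0))"
    proof -
      have "((\<lambda>r. - exp (- r\<^sup>2 / (4 * \<sigma>\<^sup>2))) \<longlongrightarrow> - exp (- 0\<^sup>2 / (4 * \<sigma>\<^sup>2))) (at_right 0)"
        by (intro tendsto_intros) (use assms in auto)
      then show ?thesis
        by (simp add: zero_ereal_def ereal_tendsto_simps)
    qed
    have "0 < 1 / (4 * \<sigma>\<^sup>2)"
      using assms by simp
    from filterlim_tendsto_pos_mult_at_top[OF tendsto_const this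
        filterlim_pow_at_top[OF pos2 filterlim_ident]]
    have "filterlim (\<lambda>r. - (1 / (4 * \<sigma>\<^sup>2) * r\<^sup>2)) at_bot at_top"
      unfolding filterlim_uminus_at_top by simp
    then have "((\<lambda>r. exp (- (1 / (4 * \<sigma>\<^sup>2) * r\<^sup>2))) \<longlongrightarrow> 0) at_top"
      by (rule filterlim_compose[OF exp_at_bot])
    then have "((\<lambda>r. - exp (- r\<^sup>2 / (4 * \<sigma>\<^sup>2))) \<longlongrightarrow> 0) at_top"
      using tendsto_minus by fastforce
    then show "((((\<lambda>r. - exp (- r\<^sup>2 / (4 * \<sigma>\<^sup>2))) \<circ> real_of_ereal) \<longlongrightarrow> 0) (at_left \<infinity>))"
      by (simp add: ereal_tendsto_simps)
    show "DERIV (\<lambda>r. - exp (- r\<^sup>2 / (4 * \<sigma>\<^sup>2))) r :> r / (2 * \<sigma>\<^sup>2) * exp (- r\<^sup>2 / (4 * \<sigma>\<^sup>2))" for r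
      using assms by (auto intro!: derivative_eq_intros simp: field_simps)
  qed (use assms in \<open>auto intro!: continuous_intros simp: zero_ereal_def\<close>)
  then have "set_integrable lborel {0<..} (\<lambda>r. r / (2 * \<sigma>\<^sup>2) * exp (- r\<^sup>2 / (4 * \<sigma>\<^sup>2)))"
    by (simp add: zero_ereal_def)
  \<comment> \<open>The fundamental theorem covers the open half-line; the integrand vanishes at 0,
    so adding the endpoint changes nothing.\<close>
  moreover have "(\<lambda>r. indicator {0<..} r *\<^sub>R (r / (2 * \<sigma>\<^sup>2) * exp (- r\<^sup>2 / (4 * \<sigma>\<^sup>2)))) =
      (\<lambda>r. indicator {0..} r *\<^sub>R (r / (2 * \<sigma>\<^sup>2) * exp (- r\<^sup>2 / (4 * \<sigma>\<^sup>2))))"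
    by (auto simp: fun_eq_iff indicator_def)
  ultimately show ?thesis
    by (simp add: set_integrable_def)
qed

lemma rate_coverage_pos:
  assumes "0 < \<sigma>" "0 \<le> lam" "0 \<le> nbar" "0 \<le> \<theta>" "0 < q"
  shows "0 < rate_coverage lam nbar \<sigma> \<theta> \<alpha> q"
proof -
  define L where "L r = inter_laplace lam nbar \<sigma> \<theta> \<alpha> q r * intra_laplace nbar \<sigma> \<theta> \<alpha> q r" for r
  define f where "f r = indicator {0..} r *\<^sub>R (r / (2 * \<sigma>\<^sup>2) * exp (- r\<^sup>2 / (4 * \<sigma>\<^sup>2)) * q *
    inter_laplace lam nbar \<sigma> \<theta> \<alpha> q r * intra_laplace nbar \<sigma> \<theta> \<alpha> q r)" for r
  define g where "g r = q * (indicator {0..} r *\<^sub>R (r / (2 * \<sigma>\<^sup>2) * exp (- r\<^sup>2 / (4 * \<sigma>\<^sup>2))))" for r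
  have fg: "f r = g r * L r" for r
    by (simp add: f_def g_def L_def)
  have L: "0 < L r" "L r \<le> 1" for r
    unfolding L_def using assms
    by (auto intro!: mult_pos_pos mult_le_one inter_laplace_le_one intra_laplace_le_one
        inter_laplace_pos intra_laplace_pos less_imp_le[OF intra_laplace_pos])
  have g0: "0 \<le> g r" for r
    using assms by (simp add: g_def indicator_def)
  have "integrable lborel g"
    unfolding g_def using set_integrable_rayleigh[OF assms(1)]
    unfolding set_integrable_def by (rule integrable_mult_right)
  \<comment> \<open>Integrability is essential here: a divergent integral would be 0 by convention,
    and positivity would fail.\<close>
  then have int: "integrable lborel f"
  proof (rule Bochner_Integration.integrable_bound)
    show "f \<in> borel_measurable lborel"
      unfolding f_def[abs_def] by measurable
    show "AE r in lborel. norm (f r) \<le> norm (g r)"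
      using L g0 by (intro AE_I2) (simp add: fg abs_mult abs_of_pos mult_left_le)
  qed
  have f0: "0 \<le> f r" for r
    using L(1)[of r] g0[of r] by (simp add: fg)
  have "0 < integral\<^sup>L lborel f"
  proof (rule ccontr)
    assume "\<not> 0 < integral\<^sup>L lborel f"
    moreover have "0 \<le> integral\<^sup>L lborel f"
      using f0 by simp
    ultimately have "integral\<^sup>L lborel f = 0"
      by simp
    then have "AE r in lborel. f r = 0"
      using integral_nonneg_eq_0_iff_AE[OF int] f0 by simp
    \<comment> \<open>All factors of \<open>f\<close> are positive for positive \<open>r\<close>, so
      a zero integral would turn the unit interval into a null set.\<close>
    then have "AE r in lborel. r \<notin> {0<..<1::real}"
    proof eventually_elim
      case (elim r)
      have "f r \<noteq> 0" if "0 < r"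
        using that assms L(1)[of r] by (simp add: fg g_def)
      with elim show ?case by auto
    qed
    then have "emeasure lborel {0<..<1::real} = 0"
      by (subst (asm) AE_iff_measurable[of "{0<..<1}"]) auto
    then show False by simp
  qed
  then show ?thesis
    by (simp add: rate_coverage_def set_lebesgue_integral_def f_def[abs_def])
qed

subsection \<open>The contribution of one file\<close>

definition file_gain :: "real \<Rightarrow> real \<Rightarrow> real \<Rightarrow> real \<Rightarrow> real" where
  "file_gain nbar Y c x = c * x + c * (1 - x) * (1 - exp (- x * nbar)) * Y"

text \<open>This is the derivative of \<open>file_gain\<close> and also the right-hand side of the
  equation for \<psi>; its values at 1 and 0 are the two thresholds in
  \<open>caching_prob\<close>.\<close>

definition marginal_gain :: "real \<Rightarrow> real \<Rightarrow> real \<Rightarrow> real \<Rightarrow> real" where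
  "marginal_gain nbar Y c x =
     c + c * (nbar * (1 - x) * exp (- nbar * x) - (1 - exp (- nbar * x))) * Y"

lemma offloading_gain_eq: "offloading_gain nbar Y p b = (\<Sum>i\<in>UNIV. file_gain nbar Y (p i) (b $ i))"
  by (simp add: offloading_gain_def file_gain_def)

lemma psi_solution_iff: "psi_solution nbar Y c v x \<longleftrightarrow> x \<in> {0..1} \<and> marginal_gain nbar Y c x = v"
  by (auto simp: psi_solution_def marginal_gain_def)

lemma marginal_gain_0: "marginal_gain nbar Y c 0 = c + nbar * c * Y"
  and marginal_gain_1: "marginal_gain nbar Y c 1 = c - c * (1 - exp (- nbar)) * Y"
  by (simp_all add: marginal_gain_def algebra_simps)

lemma file_gain_has_derivative:
  "(file_gain nbar Y c has_real_derivative marginal_gain nbar Y c x) (at x)"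
  unfolding file_gain_def[abs_def] marginal_gain_def
  by (auto intro!: derivative_eq_intros simp: algebra_simps)

lemma continuous_on_marginal_gain: "continuous_on A (marginal_gain nbar Y c)"
  unfolding marginal_gain_def[abs_def] by (intro continuous_intros)

text \<open>Here \<open>c\<close> is the request probability of one file. With \<open>Y = 0\<close>
  the gain would be linear and its derivative constant, so strictness and uniqueness would be
  lost.\<close>

locale file_parameters =
  fixes nbar Y c :: real
  assumes nbar: "0 < nbar" and Y: "0 < Y" and c: "0 < c"
begin

text \<open>The factors \<open>1 - x\<close> and \<open>exp (- nbar * x)\<close> are nonnegative and
  decreasing, hence so is their product; the strictness comes from the separate exponential
  term.\<close>

lemma marginal_gain_strict_antimono:
  assumes "0 \<le> x" "x < y" "y \<le> 1"
  shows "marginal_gain nbar Y c y < marginal_gain nbar Y c x"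
proof -
  have e: "exp (- nbar * y) < exp (- nbar * x)"
    using assms nbar by simp
  have "(1 - y) * exp (- nbar * y) \<le> (1 - x) * exp (- nbar * x)"
    using assms e by (intro mult_mono) auto
  then have "nbar * ((1 - y) * exp (- nbar * y)) \<le> nbar * ((1 - x) * exp (- nbar * x))"
    using nbar by simp
  then have "nbar * (1 - y) * exp (- nbar * y) - (1 - exp (- nbar * y))
      < nbar * (1 - x) * exp (- nbar * x) - (1 - exp (- nbar * x))"
    unfolding mult.assoc using e by linarith
  then show ?thesis
    using Y c by (simp add: marginal_gain_def)
qed

section \<open>Inverting the marginal gain on the unit interval\<close>

lemma marginal_gain_inj: "inj_on (marginal_gain nbar Y c) {0..1}"
proof (rule linorder_inj_onI)
  fix x y :: real
  assume "x < y" "x \<in> {0..1}" "y \<in> {0..1}"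
  then show "marginal_gain nbar Y c x \<noteq> marginal_gain nbar Y c y"
    using marginal_gain_strict_antimono[of x y] by simp
qed auto

lemma psi_solution_unique:
  assumes "\<not> v < marginal_gain nbar Y c 1" "\<not> v > marginal_gain nbar Y c 0"
  shows "\<exists>!x. psi_solution nbar Y c v x"
proof -
  obtain x where "0 \<le> x" "x \<le> 1" "marginal_gain nbar Y c x = v"
    using IVT2'[of "marginal_gain nbar Y c" 1 v 0] assms continuous_on_marginal_gain by auto
  then have "psi_solution nbar Y c v x"
    by (simp add: psi_solution_iff)
  moreover have "y = x" if "psi_solution nbar Y c v y" for y
    using that calculation inj_onD[OF marginal_gain_inj] by (simp add: psi_solution_iff)
  ultimately show ?thesis
    by (rule ex1I)
qed

text \<open>This replaces the definite description in \<open>psi\<close> by the equation it solves.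
  The three cases are the optimality conditions of one coordinate with multiplier
  \<open>v\<close>.\<close>

lemma caching_prob_cases:
  obtains (one) "v < marginal_gain nbar Y c 1" "caching_prob nbar Y c v = 1"
  | (zero) "v > marginal_gain nbar Y c 0" "caching_prob nbar Y c v = 0"
  | (inner) "marginal_gain nbar Y c 1 \<le> v" "v \<le> marginal_gain nbar Y c 0"
      "caching_prob nbar Y c v \<in> {0..1}"
      "marginal_gain nbar Y c (caching_prob nbar Y c v) = v"
proof -
  \<comment> \<open>The thresholds are ordered, so a \<open>v\<close> above the upper one fails the
    test that \<open>caching_prob\<close> makes first.\<close>
  have lt: "marginal_gain nbar Y c 1 < marginal_gain nbar Y c 0"
    by (rule marginal_gain_strict_antimono) auto
  have eq: "caching_prob nbar Y c v = (if v < marginal_gain nbar Y c 1 then 1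
      else if v > marginal_gain nbar Y c 0 then 0 else psi nbar Y c v)"
    by (simp only: caching_prob_def marginal_gain_0 marginal_gain_1)
  consider "v < marginal_gain nbar Y c 1" | "v > marginal_gain nbar Y c 0"
    | "\<not> v < marginal_gain nbar Y c 1" "\<not> v > marginal_gain nbar Y c 0"
    by blast
  then show ?thesis
  proof cases
    case 1
    then show ?thesis by (intro one) (simp_all add: eq)
  next
    case 2
    then show ?thesis using lt by (intro zero) (simp_all add: eq)
  next
    case 3
    then have "psi_solution nbar Y c v (psi nbar Y c v)"
      unfolding psi_def by (rule theI'[OF psi_solution_unique])
    then show ?thesis
      using 3 by (intro inner) (simp_all add: eq psi_solution_iff)
  qed
qed

lemma caching_prob_in_unit: "caching_prob nbar Y c v \<in> {0..1}"
  by (cases v rule: caching_prob_cases) auto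

section \<open>Concavity and the Lagrangian of one file\<close>

lemma file_gain_concave: "concave_on {0..1} (file_gain nbar Y c)"
proof -
  have "convex_on {0..1} (\<lambda>x. - file_gain nbar Y c x)"
  proof (rule convex_on_realI)
    show "((\<lambda>x. - file_gain nbar Y c x) has_real_derivative - marginal_gain nbar Y c x) (at x)" for x
      by (rule DERIV_minus[OF file_gain_has_derivative])
    fix x y :: real
    assume "x \<in> {0..1}" "y \<in> {0..1}" "x \<le> y"
    then show "- marginal_gain nbar Y c x \<le> - marginal_gain nbar Y c y"
      using marginal_gain_strict_antimono[of x y] by (cases "x = y") auto
  qed auto
  then show ?thesis
    by (simp add: concave_on_def)
qed

text \<open>The Lagrangian has derivative \<open>marginal_gain nbar Y c x - v\<close>, which is
  positive to the left of the caching probability and negative to its right; the mean value theorem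
  does the rest. Strictness later gives uniqueness of the optimum.\<close>

lemma caching_prob_lagrangian_max:
  assumes x: "x \<in> {0..1}" "x \<noteq> caching_prob nbar Y c v"
  shows "file_gain nbar Y c x - v * x
    < file_gain nbar Y c (caching_prob nbar Y c v) - v * caching_prob nbar Y c v"
proof -
  define k where "k = caching_prob nbar Y c v"
  define h where "h x = file_gain nbar Y c x - v * x" for x
  have h: "(h has_real_derivative marginal_gain nbar Y c x - v) (at x)" for x
    unfolding h_def[abs_def]
    by (auto intro!: derivative_eq_intros file_gain_has_derivative)
  have k: "k \<in> {0..1}"
    unfolding k_def by (rule caching_prob_in_unit)
  consider "x < k" | "k < x"
    using x k_def by linarith
  then have "h x < h k"
  proof cases
    case 1
    obtain z where z: "x < z" "z < k" "h k - h x = (k - x) * (marginal_gain nbar Y c z - v)"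
      using MVT2[of x k h "\<lambda>x. marginal_gain nbar Y c x - v", OF 1 h] by blast
    \<comment> \<open>A point \<open>x\<close> of the unit interval below \<open>k\<close> rules out
      \<open>k = 0\<close>, so only the other two cases remain.\<close>
    have "v \<le> marginal_gain nbar Y c k"
      by (cases v rule: caching_prob_cases) (use 1 x k_def in auto)
    then have "v < marginal_gain nbar Y c z"
      using marginal_gain_strict_antimono[of z k] z x k by auto
    then have "0 < (k - x) * (marginal_gain nbar Y c z - v)"
      using 1 by simp
    then show ?thesis
      using z by linarith
  next
    case 2
    obtain z where z: "k < z" "z < x" "h x - h k = (x - k) * (marginal_gain nbar Y c z - v)"
      using MVT2[of k x h "\<lambda>x. marginal_gain nbar Y c x - v", OF 2 h] by blast
    \<comment> \<open>Symmetrically, a point of the unit interval above \<open>k\<close> rules out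
      \<open>k = 1\<close>.\<close>
    have "marginal_gain nbar Y c k \<le> v"
      by (cases v rule: caching_prob_cases) (use 2 x k_def in auto)
    then have "marginal_gain nbar Y c z < v"
      using marginal_gain_strict_antimono[of k z] z x k by auto
    then have "(x - k) * (marginal_gain nbar Y c z - v) < 0"
      using 2 by (simp add: mult_pos_neg)
    then show ?thesis
      using z by linarith
  qed
  then show ?thesis
    by (simp add: h_def k_def)
qed

text \<open>Clipping \<open>v\<close> to the range of the marginal gain and then inverting yields
  the caching probability. The inverse is continuous because the marginal gain is a continuous
  injection on a compact interval.\<close>

lemma continuous_on_caching_prob: "continuous_on UNIV (caching_prob nbar Y c)"
proof -
  let ?m = "marginal_gain nbar Y c"
  let ?inv = "the_inv_into {0..1} ?m"
  let ?clip = "\<lambda>v. max (?m 1) (min v (?m 0))"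
  have le: "?m 1 \<le> ?m 0"
    using marginal_gain_strict_antimono[of 0 1] by simp
  have inv: "?inv (?m x) = x" if "x \<in> {0..1}" for x
    using the_inv_into_f_f[OF marginal_gain_inj that] .
  have cont: "continuous_on (?m ` {0..1}) ?inv"
    by (rule continuous_on_inv) (auto simp: continuous_on_marginal_gain inv)
  have clip: "?clip v \<in> ?m ` {0..1}" for v
  proof -
    have "\<exists>x\<ge>0. x \<le> 1 \<and> ?m x = ?clip v"
      by (rule IVT2') (use le in \<open>auto simp: continuous_on_marginal_gain\<close>)
    then show ?thesis by force
  qed
  have "continuous_on UNIV (\<lambda>v. ?inv (?clip v))"
    by (rule continuous_on_compose2[OF cont]) (auto intro!: continuous_intros simp: clip)
  moreover have "?inv (?clip v) = caching_prob nbar Y c v" for v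
  proof (cases v rule: caching_prob_cases)
    case one
    then show ?thesis using le inv[of 1] by simp
  next
    case zero
    then show ?thesis using le inv[of 0] by (simp add: max_def min_def)
  next
    case inner
    then show ?thesis using inv[of "caching_prob nbar Y c v"] by simp
  qed
  ultimately show ?thesis
    by simp
qed

end

subsection \<open>The constrained problem\<close>

lemma concave_on_offloading_gain:
  fixes p :: "'n::finite \<Rightarrow> real"
  assumes "\<And>i. file_parameters nbar Y (p i)"
  shows "concave_on {b :: real ^ 'n. \<forall>i. b $ i \<in> {0..1}} (offloading_gain nbar Y p)"
proof -
  \<comment> \<open>The cube is recognized as a box, whose convexity is known.\<close>
  have "{b :: real ^ 'n. \<forall>i. b $ i \<in> {0..1}} = cbox 0 1"
    by (auto simp: mem_box_cart)
  then have "convex {b :: real ^ 'n. \<forall>i. b $ i \<in> {0..1}}"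
    by (metis convex_box(1))
  moreover have "u * offloading_gain nbar Y p a + w * offloading_gain nbar Y p b
      \<le> offloading_gain nbar Y p (u *\<^sub>R a + w *\<^sub>R b)"
    if "\<forall>i. a $ i \<in> {0..1}" "\<forall>i. b $ i \<in> {0..1}" "0 \<le> u" "0 \<le> w" "u + w = 1"
    for a b :: "real ^ 'n" and u w
  proof -
    have "u * file_gain nbar Y (p i) (a $ i) + w * file_gain nbar Y (p i) (b $ i)
        \<le> file_gain nbar Y (p i) (u * a $ i + w * b $ i)" for i
      using file_parameters.file_gain_concave[OF assms, of i] that
      by (simp add: concave_on_iff)
    then show ?thesis
      by (simp add: offloading_gain_eq sum_distrib_left sum.distrib[symmetric] sum_mono)
  qed
  ultimately show ?thesis
    by (simp add: concave_on_iff)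
qed

lemma multiplier_exists:
  fixes p :: "'n::finite \<Rightarrow> real"
  assumes par: "\<And>i. file_parameters nbar Y (p i)" and m: "0 \<le> m" "m \<le> real CARD('n)"
  shows "\<exists>v. (\<Sum>i\<in>UNIV. caching_prob nbar Y (p i) v) = m"
proof -
  \<comment> \<open>The unit shifts put \<open>lo\<close> strictly below all lower thresholds and
    \<open>hi\<close> strictly above all upper ones. The sum of caching probabilities is then
    \<open>CARD('n)\<close> at \<open>lo\<close> and 0 at \<open>hi\<close>.\<close>
  define lo where "lo = Min (range (\<lambda>i. marginal_gain nbar Y (p i) 1)) - 1"
  define hi where "hi = Max (range (\<lambda>i. marginal_gain nbar Y (p i) 0)) + 1"
  have lo: "lo < marginal_gain nbar Y (p i) 1" for i
  proof -
    have "Min (range (\<lambda>i. marginal_gain nbar Y (p i) 1)) \<le> marginal_gain nbar Y (p i) 1"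
      by (rule Min_le) auto
    then show ?thesis
      unfolding lo_def by linarith
  qed
  have hi: "marginal_gain nbar Y (p i) 0 < hi" for i
  proof -
    have "marginal_gain nbar Y (p i) 0 \<le> Max (range (\<lambda>i. marginal_gain nbar Y (p i) 0))"
      by (rule Max_ge) auto
    then show ?thesis
      unfolding hi_def by linarith
  qed
  have mono: "marginal_gain nbar Y (p i) 1 < marginal_gain nbar Y (p i) 0" for i
    using file_parameters.marginal_gain_strict_antimono[OF par, of 0 1] by simp
  have one: "caching_prob nbar Y (p i) lo = 1" for i
    using lo[of i] by (simp add: caching_prob_def marginal_gain_1)
  have zero: "caching_prob nbar Y (p i) hi = 0" for i
    using hi[of i] mono[of i] by (simp add: caching_prob_def marginal_gain_0 marginal_gain_1)
  \<comment> \<open>Any file can link the two bounds; \<open>undefined\<close> merely names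
    one.\<close>
  have "lo \<le> hi"
    using lo[of undefined] mono[of undefined] hi[of undefined] by linarith
  moreover have "continuous_on {lo..hi} (\<lambda>v. \<Sum>i\<in>UNIV. caching_prob nbar Y (p i) v)"
    by (intro continuous_on_sum)
      (meson file_parameters.continuous_on_caching_prob[OF par] continuous_on_subset subset_UNIV)
  ultimately show ?thesis
    using IVT2'[of "\<lambda>v. \<Sum>i\<in>UNIV. caching_prob nbar Y (p i) v" hi m lo] m
    by (auto simp: one zero)
qed

text \<open>Feasible vectors all pay the same total price \<open>v * real M\<close>, so comparing
  Lagrangians amounts to comparing gains. Any other feasible vector loses strictly in some
  coordinate and gains in none.\<close>

lemma is_arg_max_iff_caching_prob:
  fixes p :: "'n::finite \<Rightarrow> real"
  assumes par: "\<And>i. file_parameters nbar Y (p i)"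
    and v: "(\<Sum>i\<in>UNIV. caching_prob nbar Y (p i) v) = real M"
  shows "is_arg_max (offloading_gain nbar Y p) (feasible_caching M) b
    \<longleftrightarrow> (\<forall>i. b $ i = caching_prob nbar Y (p i) v)"
proof -
  define k :: "real ^ 'n" where "k = (\<chi> i. caching_prob nbar Y (p i) v)"
  have k: "feasible_caching M k"
    using v file_parameters.caching_prob_in_unit[OF par]
    unfolding feasible_caching_def k_def by simp
  have less: "offloading_gain nbar Y p a < offloading_gain nbar Y p k"
    if a: "feasible_caching M a" "a \<noteq> k" for a
  proof -
    obtain j where j: "a $ j \<noteq> k $ j"
      using a(2) by (auto simp: vec_eq_iff)
    have lt: "file_gain nbar Y (p i) (a $ i) - v * a $ i < file_gain nbar Y (p i) (k $ i) - v * k $ i"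
      if "a $ i \<noteq> k $ i" for i
      using file_parameters.caching_prob_lagrangian_max[OF par, of "a $ i" i v] a(1) that
      by (simp add: k_def feasible_caching_def)
    have "(\<Sum>i\<in>UNIV. file_gain nbar Y (p i) (a $ i) - v * a $ i)
        < (\<Sum>i\<in>UNIV. file_gain nbar Y (p i) (k $ i) - v * k $ i)"
    proof (rule sum_strict_mono_ex1)
      show "\<forall>i\<in>UNIV. file_gain nbar Y (p i) (a $ i) - v * a $ i
          \<le> file_gain nbar Y (p i) (k $ i) - v * k $ i"
        using lt by (metis less_imp_le order_refl)
    qed (use j lt in auto)
    moreover have "(\<Sum>i\<in>UNIV. v * a $ i) = (\<Sum>i\<in>UNIV. v * k $ i)"
      using a k by (simp add: feasible_caching_def sum_distrib_left[symmetric])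
    ultimately show ?thesis
      by (simp add: offloading_gain_eq sum_subtractf)
  qed
  have "is_arg_max (offloading_gain nbar Y p) (feasible_caching M) b \<longleftrightarrow> b = k"
    using less k unfolding is_arg_max_def by (metis less_asym)
  then show ?thesis
    by (simp add: k_def vec_eq_iff)
qed

text \<open>The second conjunct makes \<open>psi\<close> well defined wherever
  \<open>caching_prob\<close> uses it, and the third keeps the fourth from being vacuous. Together
  the last two include existence and uniqueness of the maximizer.\<close>

theorem lemma3:
  fixes N M :: nat
    and \<beta> nbar \<sigma> lam \<theta> \<alpha> qs Y :: real
    and idx :: "'n::finite \<Rightarrow> nat"
    and p :: "'n \<Rightarrow> real"
  assumes "1 \<le> M" and "M < N"
    and "\<beta> \<ge> 0" and "nbar > 0" and "\<sigma> > 0" and "lam > 0" and "\<theta> > 0" and "\<alpha> > 2"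
    and idx: "bij_betw idx UNIV {1..N}"
    and p: "\<And>i. p i = zipf_prob \<beta> N (idx i)"
    and qs: "is_arg_max (rate_coverage lam nbar \<sigma> \<theta> \<alpha>) (\<lambda>q. q \<in> {0..1}) qs"
    and Y: "Y = rate_coverage lam nbar \<sigma> \<theta> \<alpha> qs"
  shows "concave_on {b :: real ^ 'n. \<forall>i. b $ i \<in> {0..1}} (offloading_gain nbar Y p)
    \<and> (\<forall>v i. \<not> v < p i - p i * (1 - exp (- nbar)) * Y \<longrightarrow> \<not> v > p i + nbar * p i * Y
          \<longrightarrow> (\<exists>!x. psi_solution nbar Y (p i) v x))
    \<and> (\<exists>v. (\<Sum>i\<in>UNIV. caching_prob nbar Y (p i) v) = real M)
    \<and> (\<forall>v. (\<Sum>i\<in>UNIV. caching_prob nbar Y (p i) v) = real M \<longrightarrow>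
          (\<forall>b. is_arg_max (offloading_gain nbar Y p) (feasible_caching M) b
               \<longleftrightarrow> (\<forall>i. b $ i = caching_prob nbar Y (p i) v)))"
proof -
  have "\<forall>q\<in>{0..1}. rate_coverage lam nbar \<sigma> \<theta> \<alpha> q \<le> Y"
    using qs unfolding is_arg_max_def Y not_less[symmetric] by blast
  \<comment> \<open>Any positive access probability would do for the comparison; at 0 the coverage
    vanishes.\<close>
  then have "rate_coverage lam nbar \<sigma> \<theta> \<alpha> 1 \<le> Y"
    by simp
  then have Y0: "0 < Y"
    using rate_coverage_pos[of \<sigma> lam nbar \<theta> 1 \<alpha>] assms(4-7) by simp
  have p0: "0 < p i" for i
  proof -
    \<comment> \<open>An index is at least 1, so its power is positive, whereas
      \<open>0 powr (- \<beta>)\<close> would be 0; it also shows the normalizing sum to be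
      nonempty.\<close>
    have "idx i \<in> {1..N}"
      using idx by (auto simp: bij_betw_def)
    then have "0 < (\<Sum>k = 1..N. real k powr (- \<beta>))"
      by (intro sum_pos) auto
    then show ?thesis
      using \<open>idx i \<in> {1..N}\<close> by (simp add: p zipf_prob_def)
  qed
  have par: "file_parameters nbar Y (p i)" for i
    using p0 Y0 \<open>nbar > 0\<close> by unfold_locales
  have "CARD('n) = N"
    using bij_betw_same_card[OF idx] by simp
  then have "\<exists>v. (\<Sum>i\<in>UNIV. caching_prob nbar Y (p i) v) = real M"
    using \<open>M < N\<close> by (intro multiplier_exists par) auto
  then show ?thesis
    using concave_on_offloading_gain[of nbar Y p, OF par]
      is_arg_max_iff_caching_prob[of nbar Y p, OF par]
      file_parameters.psi_solution_unique[OF par, unfolded marginal_gain_0 marginal_gain_1]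
    by blast
qed

end
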